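(* Let $I\subset S=K[x_1,\ldots,x_n]$ be a monomial complete intersection ideal (a monomial ideal whose minimal monomial generators form a regular sequence) minimally generated by $3$ elements. Then $\operatorname{sdepth}I=n-1$.
   Context: $K$ is a field and $S=K[x_1,\ldots,x_n]$ with its $\mathbb{Z}^n$-grading. For a nonzero finitely generated $\mathbb{Z}^n$-graded $S$-module $M$, a homogeneous $u\in M$ and $Z\subset\{x_1,\ldots,x_n\}$, $uK[Z]$ denotes the $K$-subspace of $M$ generated by all $uv$ with $v$ a monomial in $K[Z]$; it is a Stanley space of dimension $|Z|$ if it is a free $K[Z]$-module. A Stanley decomposition of $M$ is a presentation $\mathcal{D}: M=\bigoplus_{i=1}^m u_iK[Z_i]$ of $M$ as a finite direct sum of Stanley spaces, as $\mathbb{Z}^n$-graded $K$-vector spaces; $\operatorname{sdepth}\mathcal{D}=\min\{|Z_i|\}$, and $\operatorname{sdepth}M$ is the maximum of $\operatorname{sdepth}\mathcal{D}$ over all Stanley decompositions $\mathcal{D}$ of $M$. *)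

theory Defs
  imports Complex_Main "HOL-Library.Poly_Mapping" "HOL-Library.Cardinality"
begin

text \<open>
  The polynomial ring \<open>S = K[x\<^sub>1, \<dots>, x\<^sub>n]\<close>: the variables are indexed by a finite type
  \<^typ>\<open>'n\<close> (so \<open>n = CARD('n)\<close>), a power product is its exponent vector \<^typ>\<open>'n \<Rightarrow>\<^sub>0 nat\<close>, and a
  polynomial maps exponent vectors to coefficients.
\<close>

type_synonym ('n, 'k) mpoly = "('n \<Rightarrow>\<^sub>0 nat) \<Rightarrow>\<^sub>0 'k"

definition monomial :: "('n \<Rightarrow>\<^sub>0 nat) \<Rightarrow> ('n, 'k::field) mpoly"
  where "monomial t = Poly_Mapping.single t 1"

definition const :: "'k \<Rightarrow> ('n, 'k::field) mpoly"
  where "const c = Poly_Mapping.single 0 c"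

definition subring_in :: "'n set \<Rightarrow> ('n, 'k::field) mpoly set"  \<comment> \<open>the subring \<open>K[Z]\<close> of \<open>S\<close>\<close>
  where "subring_in Z = {p. \<forall>t\<in>Poly_Mapping.keys p. Poly_Mapping.keys t \<subseteq> Z}"

definition degree_part :: "('n \<Rightarrow> int) \<Rightarrow> ('n, 'k::field) mpoly set"
  where "degree_part a =
    {p. \<forall>t\<in>Poly_Mapping.keys p. \<forall>i. int (Poly_Mapping.lookup t i) = a i}"

text \<open>Ideals of \<open>S\<close> are the submodules of \<open>S\<close> over itself; \<open>ideal.span F\<close> is the ideal generated
  by \<open>F\<close>.\<close>

global_interpretation ideal: module "(*) :: ('n, 'k::field) mpoly \<Rightarrow> _"
  by unfold_locales (simp_all add: algebra_simps)


section \<open>Monomial complete intersections\<close>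

definition monomial_ideal :: "('n, 'k::field) mpoly set \<Rightarrow> bool"
  where "monomial_ideal I \<longleftrightarrow> (\<exists>T. I = ideal.span (monomial ` T))"

definition minimal_monomial_generators ::
    "('n, 'k::field) mpoly set \<Rightarrow> ('n, 'k) mpoly set \<Rightarrow> bool"
  where "minimal_monomial_generators G I \<longleftrightarrow>
    G \<subseteq> range monomial \<and> ideal.span G = I \<and> (\<forall>H. H \<subset> G \<longrightarrow> ideal.span H \<noteq> I)"

text \<open>Each \<open>fs ! i\<close> is a nonzerodivisor on \<open>S / (fs ! 0, \<dots>, fs ! (i - 1))\<close>, and
  \<open>S / (fs)\<close> is nonzero.\<close>

definition regular_sequence :: "('n, 'k::field) mpoly list \<Rightarrow> bool"
  where "regular_sequence fs \<longleftrightarrow>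
    ideal.span (set fs) \<noteq> UNIV \<and>
    (\<forall>i<length fs. \<forall>p. fs ! i * p \<in> ideal.span (set (take i fs)) \<longrightarrow>
                       p \<in> ideal.span (set (take i fs)))"

text \<open>The minimal monomial generators are only required to be regular in some order.\<close>

definition monomial_complete_intersection :: "('n, 'k::field) mpoly set \<Rightarrow> bool"
  where "monomial_complete_intersection I \<longleftrightarrow>
    monomial_ideal I \<and>
    (\<exists>fs. distinct fs \<and> minimal_monomial_generators (set fs) I \<and> regular_sequence fs)"


section \<open>Stanley decompositions and Stanley depth\<close>

text \<open>
  A \<open>\<int>\<^sup>n\<close>-graded \<open>S\<close>-module is given by its scalar multiplication \<open>scale\<close>, its carrier \<open>M\<close>, and its
  homogeneous components \<open>gr a\<close> for \<open>a \<in> \<int>\<^sup>n\<close>.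
\<close>

definition free_over :: "'r::comm_ring_1 set \<Rightarrow> ('r \<Rightarrow> 'm::ab_group_add \<Rightarrow> 'm) \<Rightarrow> 'm set \<Rightarrow> bool"
  where "free_over R scale V \<longleftrightarrow>
    (\<exists>B\<subseteq>V.
      V = {\<Sum>b\<in>F. scale (c b) b | F c. finite F \<and> F \<subseteq> B \<and> c ` F \<subseteq> R} \<and>
      (\<forall>F c. finite F \<and> F \<subseteq> B \<and> c ` F \<subseteq> R \<and> (\<Sum>b\<in>F. scale (c b) b) = 0 \<longrightarrow>
             (\<forall>b\<in>F. c b = 0)))"

text \<open>The \<open>K\<close>-subspace \<open>u K[Z]\<close>.\<close>

definition stanley_subspace ::
    "(('n, 'k::field) mpoly \<Rightarrow> 'm::ab_group_add \<Rightarrow> 'm) \<Rightarrow> 'm \<Rightarrow> 'n set \<Rightarrow> 'm set"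
  where "stanley_subspace scale u Z =
    module.span (\<lambda>c. scale (const c)) {scale (monomial t) u | t. Poly_Mapping.keys t \<subseteq> Z}"

text \<open>The condition \<open>u \<noteq> 0\<close> excludes the zero space, which is free of rank \<open>0\<close> for every \<open>Z\<close>.\<close>

definition stanley_space ::
    "(('n, 'k::field) mpoly \<Rightarrow> 'm::ab_group_add \<Rightarrow> 'm) \<Rightarrow> 'm \<Rightarrow> 'n set \<Rightarrow> bool"
  where "stanley_space scale u Z \<longleftrightarrow>
    u \<noteq> 0 \<and> free_over (subring_in Z) scale (stanley_subspace scale u Z)"

definition direct_sum :: "'m::ab_group_add set \<Rightarrow> 'm set list \<Rightarrow> bool"  \<comment> \<open>internal direct sum\<close>
  where "direct_sum M Vs \<longleftrightarrow>
    (\<forall>V\<in>set Vs. V \<subseteq> M) \<and> (\<forall>x\<in>M. \<exists>!vs. list_all2 (\<in>) vs Vs \<and> sum_list vs = x)"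

text \<open>A Stanley decomposition is the list of its pairs \<open>(u\<^sub>i, Z\<^sub>i)\<close>.  The \<open>u\<^sub>i\<close> being homogeneous, the
  summands are graded subspaces, so the direct sum is one of graded vector spaces.\<close>

definition stanley_decomposition ::
    "(('n, 'k::field) mpoly \<Rightarrow> 'm::ab_group_add \<Rightarrow> 'm) \<Rightarrow> (('n \<Rightarrow> int) \<Rightarrow> 'm set) \<Rightarrow> 'm set \<Rightarrow>
     ('m \<times> 'n set) list \<Rightarrow> bool"
  where "stanley_decomposition scale gr M D \<longleftrightarrow>
    (\<forall>(u, Z)\<in>set D. u \<in> M \<and> (\<exists>a. u \<in> gr a) \<and> stanley_space scale u Z) \<and>
    direct_sum M (map (\<lambda>(u, Z). stanley_subspace scale u Z) D)"

definition decomposition_sdepth :: "('m \<times> 'n::finite set) list \<Rightarrow> nat"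
  where "decomposition_sdepth D = Min ((\<lambda>(u, Z). card Z) ` set D)"

text \<open>For \<open>M \<noteq> 0\<close> every decomposition is nonempty, so the maximum is over values at most
  \<open>CARD('n)\<close>.\<close>

definition sdepth ::
    "(('n::finite, 'k::field) mpoly \<Rightarrow> 'm::ab_group_add \<Rightarrow> 'm) \<Rightarrow> (('n \<Rightarrow> int) \<Rightarrow> 'm set) \<Rightarrow>
     'm set \<Rightarrow> nat"
  where "sdepth scale gr M =
    Max {decomposition_sdepth D | D. stanley_decomposition scale gr M D}"

text \<open>An ideal is a module under multiplication, graded by its intersections with the graded
  components of \<open>S\<close>.\<close>

definition ideal_sdepth :: "('n::finite, 'k::field) mpoly set \<Rightarrow> nat"
  where "ideal_sdepth I = sdepth (*) (\<lambda>a. I \<inter> degree_part a) I"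

end

theory Submission
  imports Defs "HOL-Library.Disjoint_Sets"
begin

text \<open>
  Let the exponent vectors of the generators be \<open>a\<close>, \<open>b\<close>, \<open>c\<close>. The monomials of \<open>I\<close> are the disjoint
  union of those divisible by \<open>a\<close> but not \<open>c\<close>, by \<open>b\<close> but not \<open>a\<close>, by \<open>c\<close> but not \<open>b\<close>, and by all
  three. The last class is one box \<open>d + \<nat>\<^sup>n\<close>. The monomials above \<open>a\<close> but not above \<open>c\<close> split into
  boxes of codimension one: as long as some \<open>a\<^sub>i < c\<^sub>i\<close>, cut off the slice \<open>w\<^sub>i = a\<^sub>i\<close>, no point of
  which is above \<open>c\<close>, and replace \<open>a\<close> by \<open>a + e\<^sub>i\<close>. This gives a Stanley decomposition of depth at
  least \<open>n - 1\<close>. In a decomposition of depth \<open>n\<close> every summand is \<open>u S\<close>; two such summands both contain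
  the product of their generators, so there is only one and \<open>I\<close> is principal, contradicting minimality.
\<close>

section \<open>Polynomials with prescribed support\<close>

text \<open>Ideals, Stanley spaces and summands are all described in this form: a subspace spanned
  by monomials is determined by its exponent set, so sums and intersections become questions about
  sets of exponents.\<close>

abbreviation (input) supported :: "('n \<Rightarrow>\<^sub>0 nat) set \<Rightarrow> ('n, 'k::field) mpoly set"
  where "supported E \<equiv> {p. Poly_Mapping.keys p \<subseteq> E}"

text \<open>By cancellation, only \<open>s\<close> adds up with \<open>t\<close> to
  \<open>t + s\<close>, so the convolution sum has a single term.\<close>

lemma lookup_single_mult:
  fixes p :: "'a::cancel_comm_monoid_add \<Rightarrow>\<^sub>0 'b::semiring_0"
  shows "Poly_Mapping.lookup (Poly_Mapping.single t c * p) (t + s) = c * Poly_Mapping.lookup p s"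
  by (simp add: lookup_mult lookup_single when_mult)

lemma sum_single_keys:
  "(\<Sum>s\<in>Poly_Mapping.keys p. Poly_Mapping.single s (Poly_Mapping.lookup p s)) = p"
proof (rule poly_mapping_eqI)
  fix k
  have "Poly_Mapping.lookup (\<Sum>s\<in>Poly_Mapping.keys p. Poly_Mapping.single s (Poly_Mapping.lookup p s)) k
      = (\<Sum>s\<in>Poly_Mapping.keys p. if s = k then Poly_Mapping.lookup p s else 0)"
    by (simp add: lookup_sum lookup_single when_def)
  also have "\<dots> = Poly_Mapping.lookup p k"
    by (simp add: sum.delta in_keys_iff)
  finally show "Poly_Mapping.lookup (\<Sum>s\<in>Poly_Mapping.keys p. Poly_Mapping.single s (Poly_Mapping.lookup p s)) k
      = Poly_Mapping.lookup p k" .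
qed

lemma monomial_neq_0: "monomial t \<noteq> (0 :: ('n, 'k::field) mpoly)"
  by (metis monomial_def lookup_single_eq lookup_zero one_neq_zero)

section \<open>Boxes of exponents and the support of monomial ideals\<close>

text \<open>The exponent set of the Stanley space x^t K[Z]. For \<open>Z = UNIV\<close> it consists
  of all multiples of x^t, that is, the exponents of a principal monomial ideal.\<close>

definition box :: "('n \<Rightarrow>\<^sub>0 nat) \<Rightarrow> 'n set \<Rightarrow> ('n \<Rightarrow>\<^sub>0 nat) set"
  where "box t Z = {t + r | r. Poly_Mapping.keys r \<subseteq> Z}"

lemma mem_box_iff:
  "s \<in> box t Z \<longleftrightarrow>
    (\<forall>i. Poly_Mapping.lookup t i \<le> Poly_Mapping.lookup s i) \<and>
    (\<forall>i. i \<notin> Z \<longrightarrow> Poly_Mapping.lookup s i = Poly_Mapping.lookup t i)" (is "_ \<longleftrightarrow> ?R")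
proof
  assume "s \<in> box t Z"
  then obtain r where "s = t + r" "Poly_Mapping.keys r \<subseteq> Z" by (auto simp: box_def)
  then show ?R by (auto simp: lookup_add in_keys_iff)
next
  assume R: ?R
  \<comment> \<open>Subtraction of exponents is truncated; it inverts addition here because
    \<open>t\<close> lies below \<open>s\<close> in every coordinate.\<close>
  then have "s = t + (s - t)"
    by (intro poly_mapping_eqI) (simp add: lookup_add lookup_minus)
  moreover have "Poly_Mapping.keys (s - t) \<subseteq> Z"
    using R by (auto simp: in_keys_iff lookup_minus)
  ultimately show "s \<in> box t Z" unfolding box_def by blast
qed

lemma self_mem_box: "t \<in> box t Z"
  by (simp add: mem_box_iff)

lemma box_subset:
  assumes "t \<in> box t' Z'" and "Z \<subseteq> Z'"
  shows "box t Z \<subseteq> box t' Z'"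
proof
  fix s assume "s \<in> box t Z"
  moreover obtain r where r: "t = t' + r" "Poly_Mapping.keys r \<subseteq> Z'" using assms(1) by (auto simp: box_def)
  ultimately obtain q where q: "s = t' + (r + q)" "Poly_Mapping.keys q \<subseteq> Z" by (auto simp: box_def add.assoc)
  then have "Poly_Mapping.keys (r + q) \<subseteq> Z'" using r assms(2) keys_add[of r q] by blast
  then show "s \<in> box t' Z'" using q by (auto simp: box_def)
qed

lemma keys_mult_box:
  assumes "Poly_Mapping.keys f \<subseteq> box t Z" and "\<And>r. r \<in> Poly_Mapping.keys g \<Longrightarrow> Poly_Mapping.keys r \<subseteq> Z"
  shows "Poly_Mapping.keys (g * f) \<subseteq> box t Z"
proof
  fix s assume "s \<in> Poly_Mapping.keys (g * f)"
  then obtain a b where "s = a + b" "a \<in> Poly_Mapping.keys g" "b \<in> Poly_Mapping.keys f"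
    using keys_mult by blast
  moreover from this obtain r where "b = t + r" "Poly_Mapping.keys r \<subseteq> Z"
    using assms(1) by (auto simp: box_def)
  moreover have "Poly_Mapping.keys (a + r) \<subseteq> Z"
    using calculation assms(2) keys_add[of a r] by blast
  ultimately show "s \<in> box t Z"
    by (auto simp: box_def intro!: exI[of _ "a + r"] simp: add.left_commute)
qed

text \<open>The right-hand side is closed under multiplication by S, since adding an exponent stays
  inside a full box. Conversely, each of its terms is a term times a generator, and a polynomial is
  the sum of its terms.\<close>

lemma span_monomials:
  "ideal.span (monomial ` T :: ('n, 'k::field) mpoly set) = supported (\<Union>t\<in>T. box t UNIV)"
proof (rule ideal.span_unique)
  show "(monomial ` T :: ('n, 'k) mpoly set) \<subseteq> supported (\<Union>t\<in>T. box t UNIV)"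
    by (auto simp: monomial_def intro: self_mem_box)
  show "ideal.subspace (supported (\<Union>t\<in>T. box t UNIV) :: ('n, 'k) mpoly set)"
  proof (rule ideal.subspaceI; clarify)
    fix c x :: "('n, 'k) mpoly" and s
    assume x: "Poly_Mapping.keys x \<subseteq> (\<Union>t\<in>T. box t UNIV)" and "s \<in> Poly_Mapping.keys (c * x)"
    then obtain a b where ab: "s = a + b" "b \<in> Poly_Mapping.keys x"
      using keys_mult by blast
    then obtain t where "t \<in> T" "b \<in> box t UNIV" using x by blast
    then show "s \<in> (\<Union>t\<in>T. box t UNIV)"
      using ab by (intro UN_I[of t]) (auto simp: mem_box_iff lookup_add intro: trans_le_add2)
  qed (auto dest!: subsetD[OF keys_add])
next
  fix M :: "('n, 'k) mpoly set"
  assume M: "monomial ` T \<subseteq> M" "ideal.subspace M"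
  show "supported (\<Union>t\<in>T. box t UNIV) \<subseteq> M"
  proof clarify
    fix p :: "('n, 'k) mpoly" assume p: "Poly_Mapping.keys p \<subseteq> (\<Union>t\<in>T. box t UNIV)"
    have "Poly_Mapping.single s (Poly_Mapping.lookup p s) \<in> M" if s: "s \<in> Poly_Mapping.keys p" for s
    proof -
      obtain t r where t: "t \<in> T" and s_eq: "s = t + r" using s p by (auto simp: box_def)
      have "Poly_Mapping.single r (Poly_Mapping.lookup p s) * monomial t \<in> M"
        using M t by (intro ideal.subspace_scale) auto
      then show ?thesis by (simp add: s_eq monomial_def mult_single add.commute)
    qed
    then have "(\<Sum>s\<in>Poly_Mapping.keys p. Poly_Mapping.single s (Poly_Mapping.lookup p s)) \<in> M"
      by (rule ideal.subspace_sum[OF M(2)])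
    then show "p \<in> M" by (simp add: sum_single_keys)
  qed
qed

section \<open>Stanley spaces generated by a term\<close>

text \<open>S as a vector space over K, with scalars embedded as constants exactly as in
  \<open>stanley_subspace\<close>, so that the laws of spans apply to it.\<close>

interpretation vec: module "\<lambda>c. (*) (const c :: ('n, 'k::field) mpoly)"
  by unfold_locales (simp_all add: const_def distrib_left distrib_right single_add mult_single flip: mult.assoc)

text \<open>An arbitrary nonzero coefficient \<open>c\<close> is allowed because the upper bound
  meets arbitrary homogeneous generators, which are terms but need not be monic.\<close>

lemma stanley_subspace_term:
  fixes c :: "'k::field"
  assumes "c \<noteq> 0"
  shows "stanley_subspace (*) (Poly_Mapping.single t c :: ('n, 'k) mpoly) Z = supported (box t Z)"
  unfolding stanley_subspace_def
proof (rule vec.span_unique)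
  show "{monomial r * Poly_Mapping.single t c |r. Poly_Mapping.keys r \<subseteq> Z} \<subseteq> supported (box t Z)"
    using assms by (auto simp: monomial_def mult_single box_def add.commute)
  show "vec.subspace (supported (box t Z) :: ('n, 'k) mpoly set)"
  proof (rule vec.subspaceI; clarify)
    fix d :: 'k and x :: "('n, 'k) mpoly" and s
    assume x: "Poly_Mapping.keys x \<subseteq> box t Z" and "s \<in> Poly_Mapping.keys (const d * x)"
    then show "s \<in> box t Z"
      using keys_mult_box[OF x, of "const d"] by (fastforce simp: const_def split: if_splits)
  qed (auto dest!: subsetD[OF keys_add])
next
  fix M :: "('n, 'k) mpoly set"
  assume M: "{monomial r * Poly_Mapping.single t c |r. Poly_Mapping.keys r \<subseteq> Z} \<subseteq> M" "vec.subspace M"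
  show "supported (box t Z) \<subseteq> M"
  proof clarify
    fix p :: "('n, 'k) mpoly" assume p: "Poly_Mapping.keys p \<subseteq> box t Z"
    have "Poly_Mapping.single s (Poly_Mapping.lookup p s) \<in> M" if s: "s \<in> Poly_Mapping.keys p" for s
    proof -
      obtain r where r: "Poly_Mapping.keys r \<subseteq> Z" and s_eq: "s = t + r" using s p by (auto simp: box_def)
      \<comment> \<open>The generator already carries \<open>c\<close>, so the wanted coefficient is
        divided by it.\<close>
      have "const (Poly_Mapping.lookup p s / c) * (monomial r * Poly_Mapping.single t c) \<in> M"
        using M r by (intro vec.subspace_scale) auto
      then show ?thesis using assms by (simp add: s_eq monomial_def const_def mult_single add.commute)
    qed
    then have "(\<Sum>s\<in>Poly_Mapping.keys p. Poly_Mapping.single s (Poly_Mapping.lookup p s)) \<in> M"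
      by (rule vec.subspace_sum[OF M(2)])
    then show "p \<in> M" by (simp add: sum_single_keys)
  qed
qed

lemma supported_box_multiple:
  fixes p :: "('n, 'k::field) mpoly"
  assumes "Poly_Mapping.keys p \<subseteq> box t Z"
  obtains q where "q \<in> subring_in Z" "p = q * monomial t"
proof -
  \<comment> \<open>The quotient of \<open>p\<close> by x^t, obtained by shifting every exponent
    down by \<open>t\<close>.\<close>
  define q where "q = (\<Sum>s\<in>Poly_Mapping.keys p. Poly_Mapping.single (s - t) (Poly_Mapping.lookup p s))"
  have split: "Poly_Mapping.keys (s - t) \<subseteq> Z" "s - t + t = s" if s: "s \<in> Poly_Mapping.keys p" for s
  proof -
    obtain r where "s = t + r" "Poly_Mapping.keys r \<subseteq> Z" using s assms by (auto simp: box_def)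
    then show "Poly_Mapping.keys (s - t) \<subseteq> Z" "s - t + t = s" by (simp_all add: add.commute)
  qed
  have "q * monomial t = (\<Sum>s\<in>Poly_Mapping.keys p. Poly_Mapping.single s (Poly_Mapping.lookup p s))"
    unfolding q_def sum_distrib_right by (intro sum.cong) (simp_all add: monomial_def mult_single split)
  moreover have "q \<in> subring_in Z"
  proof -
    have "Poly_Mapping.keys q \<subseteq> (\<lambda>s. s - t) ` Poly_Mapping.keys p"
      unfolding q_def by (rule order_trans[OF keys_sum]) auto
    then show ?thesis using split by (auto simp: subring_in_def)
  qed
  ultimately show thesis using that by (simp add: sum_single_keys)
qed

lemma mult_single_eq_0_iff:
  fixes p :: "('n, 'k::field) mpoly"
  assumes "c \<noteq> 0"
  shows "p * Poly_Mapping.single t c = 0 \<longleftrightarrow> p = 0"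
proof
  assume "p * Poly_Mapping.single t c = 0"
  then have "c * Poly_Mapping.lookup p s = 0" for s
    using lookup_single_mult[of t c p s] by (simp add: mult.commute)
  then show "p = 0" using assms by (intro poly_mapping_eqI) simp
qed simp

text \<open>The generator alone is a basis over K[Z]: it spans because x^t can be factored out of
  every element, and it is independent because multiplication by a nonzero term is
  injective.\<close>

lemma stanley_space_monomial:
  "stanley_space (*) (monomial t :: ('n, 'k::field) mpoly) Z"
  unfolding stanley_space_def free_over_def
proof (intro conjI exI[of _ "{monomial t}"] allI impI ballI)
  have V: "stanley_subspace (*) (monomial t :: ('n, 'k) mpoly) Z = supported (box t Z)"
    by (simp add: monomial_def stanley_subspace_term)
  show "monomial t \<noteq> (0 :: ('n, 'k) mpoly)"
    by (rule monomial_neq_0)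
  show "{monomial t} \<subseteq> stanley_subspace (*) (monomial t :: ('n, 'k) mpoly) Z"
    by (simp add: V) (simp add: monomial_def self_mem_box)
  show "stanley_subspace (*) (monomial t :: ('n, 'k) mpoly) Z =
    {\<Sum>b\<in>F. c b * b |F c. finite F \<and> F \<subseteq> {monomial t} \<and> c ` F \<subseteq> subring_in Z}" (is "_ = ?R")
  proof (intro equalityI subsetI)
    fix p assume "p \<in> stanley_subspace (*) (monomial t :: ('n, 'k) mpoly) Z"
    then obtain q where "q \<in> subring_in Z" "p = q * monomial t"
      using V supported_box_multiple[of p t Z] by blast
    then show "p \<in> ?R"
      by (intro CollectI exI[of _ "{monomial t}"] exI[of _ "\<lambda>_. q"]) auto
  next
    fix p assume "p \<in> ?R"
    then obtain F c where F: "F \<subseteq> {monomial t}" "c ` F \<subseteq> subring_in Z" and p: "p = (\<Sum>b\<in>F. c b * b)"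
      by blast
    consider "F = {}" | "F = {monomial t}" using F by blast
    then show "p \<in> stanley_subspace (*) (monomial t :: ('n, 'k) mpoly) Z"
    proof cases
      case 2
      have "Poly_Mapping.keys (c (monomial t) * monomial t) \<subseteq> box t Z"
        using F 2 by (intro keys_mult_box) (auto simp: subring_in_def monomial_def self_mem_box)
      then show ?thesis by (simp add: V p 2)
    qed (simp add: V p)
  qed
next
  fix F and c :: "('n, 'k) mpoly \<Rightarrow> ('n, 'k) mpoly" and b
  assume A: "finite F \<and> F \<subseteq> {monomial t} \<and> c ` F \<subseteq> subring_in Z \<and> (\<Sum>b\<in>F. c b * b) = 0" and "b \<in> F"
  then have "F = {monomial t}" "b = monomial t" by auto
  with A show "c b = 0" by (simp add: monomial_def mult_single_eq_0_iff)
qed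

text \<open>In the fine grading a degree determines the exponent vector, so each component of S is
  at most one-dimensional over K.\<close>

lemma homogeneous_term:
  assumes "p \<in> degree_part a" "p \<noteq> 0"
  obtains t c where "p = Poly_Mapping.single t c" "c \<noteq> 0"
proof -
  obtain t where t: "t \<in> Poly_Mapping.keys p"
    using assms(2) by (metis keys_eq_empty equals0I)
  have "s = t" if "s \<in> Poly_Mapping.keys p" for s
    using assms(1) t that by (intro poly_mapping_eqI) (metis (mono_tags, lifting) degree_part_def mem_Collect_eq of_nat_eq_iff)
  then have "Poly_Mapping.keys p = {t}" using t by blast
  then have "p = Poly_Mapping.single t (Poly_Mapping.lookup p t)"
    using sum_single_keys[of p] by simp
  then show thesis using that t by (metis in_keys_iff)
qed

lemma single_in_degree_part:
  "Poly_Mapping.single t c \<in> degree_part (\<lambda>i. int (Poly_Mapping.lookup t i))"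
  by (auto simp: degree_part_def)

section \<open>Direct sums of supported subspaces\<close>

text \<open>Splitting off the head of the list, the first summand is forced to be the part of
  \<open>x\<close> with exponents in the first set; the remainder is handled by induction.\<close>

lemma ex1_supported_sum:
  fixes x :: "('n, 'k::field) mpoly"
  assumes "sorted_wrt (\<lambda>A B. A \<inter> B = {}) Es" and "Poly_Mapping.keys x \<subseteq> \<Union>(set Es)"
  shows "\<exists>!vs. list_all2 (\<in>) vs (map supported Es) \<and> sum_list vs = x"
  using assms
proof (induction Es arbitrary: x)
  case Nil
  then show ?case by (auto simp: list_all2_Nil2)
next
  case (Cons E Es)
  define y where "y = Poly_Mapping.mapp (\<lambda>k v. v when k \<in> E) x"
  have y: "Poly_Mapping.lookup y k = (Poly_Mapping.lookup x k when k \<in> E)" for k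
    by (auto simp: y_def lookup_mapp when_def in_keys_iff)
  have yE: "Poly_Mapping.keys y \<subseteq> E" by (auto simp: in_keys_iff y)
  have "Poly_Mapping.keys (x - y) \<subseteq> \<Union>(set Es)"
    using Cons.prems(2) by (auto simp: in_keys_iff y lookup_minus when_def subset_iff split: if_splits)
  then have ex1: "\<exists>!vs. list_all2 (\<in>) vs (map supported Es) \<and> sum_list vs = x - y"
    using Cons.IH Cons.prems(1) by simp
  \<comment> \<open>On \<open>E\<close> the later summands vanish by disjointness, and off
    \<open>E\<close> the head vanishes, so the coefficients of \<open>v\<close> are determined by
    \<open>x\<close>.\<close>
  have first: "v = y" if "Poly_Mapping.keys v \<subseteq> E" "list_all2 (\<in>) ws (map supported Es)" "v + sum_list ws = x" for v ws
  proof (rule poly_mapping_eqI)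
    fix k
    have disj: "E \<inter> \<Union>(set Es) = {}" using Cons.prems(1) by auto
    have "Poly_Mapping.keys (sum_list ws) \<subseteq> \<Union>(set Es)"
      using that(2)
    proof (induction ws arbitrary: Es)
      case (Cons w ws)
      then obtain E' Es' where "Es = E' # Es'" "Poly_Mapping.keys w \<subseteq> E'" "list_all2 (\<in>) ws (map supported Es')"
        by (auto simp: list_all2_Cons1 map_eq_Cons_conv)
      then show ?case using Cons.IH[of Es'] keys_add[of w "sum_list ws"] by auto
    qed simp
    then show "Poly_Mapping.lookup v k = Poly_Mapping.lookup y k"
      using that(1) disj unfolding y that(3)[symmetric] lookup_add
      by (cases "k \<in> E") (auto simp: not_in_keys_iff_lookup_eq_zero[symmetric])
  qed
  show ?case
  proof -
    from ex1 obtain vs where vs: "list_all2 (\<in>) vs (map supported Es)" "sum_list vs = x - y" by blast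
    show ?thesis
    proof (rule ex1I[of _ "y # vs"])
      show "list_all2 (\<in>) (y # vs) (map supported (E # Es)) \<and> sum_list (y # vs) = x"
        using vs yE by simp
    next
      fix us assume us: "list_all2 (\<in>) us (map supported (E # Es)) \<and> sum_list us = x"
      then obtain v ws where vw: "us = v # ws" "Poly_Mapping.keys v \<subseteq> E" "list_all2 (\<in>) ws (map supported Es)"
        by (auto simp: list_all2_Cons2)
      then have "v = y" using us first by simp
      moreover have "ws = vs" using us vw vs ex1 \<open>v = y\<close> by (auto simp: algebra_simps)
      ultimately show "us = y # vs" using vw by simp
    qed
  qed
qed

lemma direct_sum_supported:
  assumes "sorted_wrt (\<lambda>A B. A \<inter> B = {}) Es"
  shows "direct_sum (supported (\<Union>(set Es)) :: ('n, 'k::field) mpoly set) (map supported Es)"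
  unfolding direct_sum_def
proof (intro conjI ballI)
  fix x :: "('n, 'k) mpoly" assume "x \<in> supported (\<Union>(set Es))"
  then show "\<exists>!vs. list_all2 (\<in>) vs (map supported Es) \<and> sum_list vs = x"
    by (intro ex1_supported_sum[OF assms]) simp
qed auto

text \<open>Placing \<open>x\<close> in the first or in the second position, with zeros elsewhere,
  gives two representations of \<open>x\<close>, which must coincide. The summands are bare sets,
  hence the requirement that each contain 0.\<close>

lemma direct_sum_two_disjoint:
  assumes "direct_sum M (V # W # Vs)" and "x \<in> V" "x \<in> W" and zero: "\<forall>U\<in>set (V # W # Vs). 0 \<in> U"
  shows "x = 0"
proof -
  have 0: "list_all2 (\<in>) (map (\<lambda>_. 0) Vs) Vs" and s: "sum_list (map (\<lambda>_. 0) Vs) = x - x"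
    using zero by (auto simp: list_all2_conv_all_nth)
  have "list_all2 (\<in>) (x # 0 # map (\<lambda>_. 0) Vs) (V # W # Vs)"
       "list_all2 (\<in>) (0 # x # map (\<lambda>_. 0) Vs) (V # W # Vs)"
    using assms 0 by auto
  moreover have "x \<in> M" using assms unfolding direct_sum_def by auto
  ultimately have "x # 0 # map (\<lambda>_. 0) Vs = 0 # x # map (\<lambda>_. 0) Vs"
    using assms(1) s unfolding direct_sum_def
    by (metis (no_types, lifting) sum_list.Cons add_0 add_0_right diff_self)
  then show ?thesis by simp
qed

section \<open>Partitions into boxes\<close>

text \<open>The combinatorial shadow of a Stanley decomposition of depth at least \<open>k\<close>.
  Disjointness is indexed by the pairs, so distinct pairs give distinct summands.\<close>

definition box_partition :: "nat \<Rightarrow> (('n \<Rightarrow>\<^sub>0 nat) \<times> 'n set) set \<Rightarrow> ('n \<Rightarrow>\<^sub>0 nat) set \<Rightarrow> bool"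
  where "box_partition k F E \<longleftrightarrow>
    finite F \<and> (\<forall>(t, Z)\<in>F. k \<le> card Z) \<and> disjoint_family_on (\<lambda>(t, Z). box t Z) F \<and>
    (\<Union>(t, Z)\<in>F. box t Z) = E"

lemma box_partition_empty: "box_partition k {} {}"
  by (simp add: box_partition_def disjoint_family_on_def)

lemma box_partition_box: "k \<le> card Z \<Longrightarrow> box_partition k {(t, Z)} (box t Z)"
  by (simp add: box_partition_def disjoint_family_on_def)

lemma box_partition_Un:
  assumes "box_partition k F E" "box_partition k F' E'" "E \<inter> E' = {}"
  shows "box_partition k (F \<union> F') (E \<union> E')"
  unfolding box_partition_def
proof (intro conjI)
  have F: "finite F" "\<forall>(t, Z)\<in>F. k \<le> card Z" "disjoint_family_on (\<lambda>(t, Z). box t Z) F"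
      "(\<Union>(t, Z)\<in>F. box t Z) = E"
    and F': "finite F'" "\<forall>(t, Z)\<in>F'. k \<le> card Z" "disjoint_family_on (\<lambda>(t, Z). box t Z) F'"
      "(\<Union>(t, Z)\<in>F'. box t Z) = E'"
    using assms by (simp_all add: box_partition_def)
  show "finite (F \<union> F')" "\<forall>(t, Z)\<in>F \<union> F'. k \<le> card Z"
    using F F' by blast+
  show "(\<Union>(t, Z)\<in>F \<union> F'. box t Z) = E \<union> E'"
    using F(4) F'(4) by simp
  have "(\<lambda>(t, Z). box t Z) x \<inter> (\<lambda>(t, Z). box t Z) y = {}" if "x \<in> F" "y \<in> F'" for x y
  proof -
    have "(\<lambda>(t, Z). box t Z) x \<subseteq> E" "(\<lambda>(t, Z). box t Z) y \<subseteq> E'"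
      using that F(4) F'(4) by blast+
    then show ?thesis using assms(3) by blast
  qed
  then show "disjoint_family_on (\<lambda>(t, Z). box t Z) (F \<union> F')"
    using F(3) F'(3) unfolding disjoint_family_on_def by (metis Un_iff Int_commute)
qed

lemma box_partition_not_above:
  fixes a c :: "'n::finite \<Rightarrow>\<^sub>0 nat"
  shows "\<exists>F. box_partition (CARD('n) - 1) F (box a UNIV - box c UNIV)"
\<comment> \<open>The measure is the total deficit of \<open>a\<close> below \<open>c\<close>.
  Truncated subtraction ignores coordinates where \<open>a\<close> has already reached
  \<open>c\<close>, so raising one deficient coordinate by 1 lowers the sum.\<close>
proof (induction "\<Sum>i\<in>UNIV. Poly_Mapping.lookup c i - Poly_Mapping.lookup a i" arbitrary: a rule: less_induct)
  case less
  show ?case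
  proof (cases "a \<in> box c UNIV")
    case True
    then have "box a UNIV - box c UNIV = {}" using box_subset by blast
    then show ?thesis using box_partition_empty by metis
  next
    case False
    then obtain i where i: "Poly_Mapping.lookup a i < Poly_Mapping.lookup c i"
      by (auto simp: mem_box_iff not_le)
    define a' where "a' = a + Poly_Mapping.single i 1"
    have a': "Poly_Mapping.lookup a' j = Poly_Mapping.lookup a j + (if j = i then 1 else 0)" for j
      by (simp add: a'_def lookup_add lookup_single when_def)
    have "(\<Sum>j\<in>UNIV. Poly_Mapping.lookup c j - Poly_Mapping.lookup a' j)
        < (\<Sum>j\<in>UNIV. Poly_Mapping.lookup c j - Poly_Mapping.lookup a j)"
      using i by (intro sum_strict_mono_ex1) (auto simp: a' intro!: exI[of _ i])
    from less[OF this] obtain F where F: "box_partition (CARD('n) - 1) F (box a' UNIV - box c UNIV)" ..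
    have "card (- {i}) = CARD('n) - 1" by (simp add: Compl_eq_Diff_UNIV card_Diff_singleton)
    then have B: "box_partition (CARD('n) - 1) {(a, - {i})} (box a (- {i}))"
      by (intro box_partition_box) simp
    have upper: "s \<in> box a' UNIV \<longleftrightarrow> s \<in> box a UNIV \<and> Poly_Mapping.lookup a i < Poly_Mapping.lookup s i" for s
    proof
      assume "s \<in> box a' UNIV"
      then have *: "Poly_Mapping.lookup a j + (if j = i then 1 else 0) \<le> Poly_Mapping.lookup s j" for j
        by (simp add: mem_box_iff a')
      have "Poly_Mapping.lookup a j \<le> Poly_Mapping.lookup s j" for j
        using *[of j] by (rule add_leD1)
      then show "s \<in> box a UNIV \<and> Poly_Mapping.lookup a i < Poly_Mapping.lookup s i"
        using *[of i] by (simp add: mem_box_iff)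
    qed (simp add: mem_box_iff a')
    have lower: "s \<in> box a (- {i}) \<longleftrightarrow> s \<in> box a UNIV \<and> Poly_Mapping.lookup s i = Poly_Mapping.lookup a i" for s
      by (auto simp: mem_box_iff)
    \<comment> \<open>The slice keeps coordinate \<open>i\<close> frozen at a value below that of
      \<open>c\<close>, so it can be taken whole.\<close>
    have off: "s \<notin> box c UNIV" if "s \<in> box a (- {i})" for s
      using that i by (auto simp: mem_box_iff not_le intro: exI[of _ i])
    have "box a (- {i}) \<inter> (box a' UNIV - box c UNIV) = {}"
      by (auto simp: upper lower)
    moreover have "box a (- {i}) \<union> (box a' UNIV - box c UNIV) = box a UNIV - box c UNIV"
    proof -
      have "s \<in> box a UNIV \<longleftrightarrow> s \<in> box a (- {i}) \<or> s \<in> box a' UNIV" for s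
        unfolding upper lower by (auto simp: mem_box_iff le_less)
      then show ?thesis using off by blast
    qed
    ultimately show ?thesis using box_partition_Un[OF B F] by metis
  qed
qed

lemma box_Int_box:
  fixes a b :: "'n \<Rightarrow>\<^sub>0 nat"
  shows "\<exists>d. box a UNIV \<inter> box b UNIV = box d UNIV"
\<comment> \<open>With truncated subtraction this is the coordinatewise maximum, the exponent of the
  least common multiple.\<close>
proof (intro exI[of _ "a + (b - a)"] set_eqI)
  fix s
  have "Poly_Mapping.lookup a i + (Poly_Mapping.lookup b i - Poly_Mapping.lookup a i) \<le> n \<longleftrightarrow>
      Poly_Mapping.lookup a i \<le> n \<and> Poly_Mapping.lookup b i \<le> n" for i n by auto
  then show "s \<in> box a UNIV \<inter> box b UNIV \<longleftrightarrow> s \<in> box (a + (b - a)) UNIV"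
    by (simp add: mem_box_iff lookup_add lookup_minus all_conj_distrib)
qed

text \<open>A point in some but not all of the three sets lies in exactly one of the cyclic
  differences. These are disjoint because among three sets any two are neighbours in the cycle: for
  each pair of differences, one requires membership in a set that the other excludes.\<close>

lemma box_partition_three:
  fixes a b c :: "'n::finite \<Rightarrow>\<^sub>0 nat"
  shows "\<exists>F. box_partition (CARD('n) - 1) F (box a UNIV \<union> box b UNIV \<union> box c UNIV)"
proof -
  let ?A = "box a UNIV" and ?B = "box b UNIV" and ?C = "box c UNIV" and ?k = "CARD('n) - 1"
  obtain F1 F2 F3 where F: "box_partition ?k F1 (?A - ?C)" "box_partition ?k F2 (?B - ?A)"
      "box_partition ?k F3 (?C - ?B)"
    using box_partition_not_above by meson
  obtain d where d: "?A \<inter> ?B \<inter> ?C = box d UNIV" using box_Int_box by metis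
  then have F4: "box_partition ?k {(d, UNIV)} (?A \<inter> ?B \<inter> ?C)"
    using box_partition_box[of ?k UNIV d] by simp
  have "box_partition ?k (F1 \<union> F2 \<union> F3 \<union> {(d, UNIV)})
      ((?A - ?C) \<union> (?B - ?A) \<union> (?C - ?B) \<union> (?A \<inter> ?B \<inter> ?C))"
    by (intro box_partition_Un F F4) auto
  moreover have "(?A - ?C) \<union> (?B - ?A) \<union> (?C - ?B) \<union> (?A \<inter> ?B \<inter> ?C) = ?A \<union> ?B \<union> ?C" by blast
  ultimately show ?thesis by auto
qed

section \<open>Stanley depth\<close>

lemma stanley_decomposition_of_box_partition:
  fixes E :: "('n::finite \<Rightarrow>\<^sub>0 nat) set"
  assumes F: "box_partition k F E" and "E \<noteq> {}"
  obtains D where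
    "stanley_decomposition (*) (\<lambda>a. supported E \<inter> degree_part a) (supported E :: ('n, 'k::field) mpoly set) D"
    "k \<le> decomposition_sdepth D"
proof -
  let ?I = "supported E :: ('n, 'k) mpoly set"
  have finF: "finite F" and cardF: "\<And>t Z. (t, Z) \<in> F \<Longrightarrow> k \<le> card Z"
    and disjF: "disjoint_family_on (\<lambda>(t, Z). box t Z) F" and E: "(\<Union>(t, Z)\<in>F. box t Z) = E"
    using F by (auto simp: box_partition_def)
  obtain xs where xs: "set xs = F" "distinct xs" using finite_distinct_list[OF finF] by blast
  define Es where "Es = map (\<lambda>(t, Z). box t Z) xs"
  \<comment> \<open>A list without repetitions turns disjointness for distinct pairs into
    disjointness for distinct positions.\<close>
  have "sorted_wrt (\<lambda>A B. A \<inter> B = {}) (map (\<lambda>(t, Z). box t Z) ys)" if "set ys \<subseteq> F" "distinct ys" for ys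
    using that
  proof (induction ys)
    case (Cons y ys)
    have "(\<lambda>(t, Z). box t Z) y \<inter> (\<lambda>(t, Z). box t Z) z = {}" if "z \<in> set ys" for z
      using Cons.prems that disjF by (intro disjoint_family_onD[OF disjF]) auto
    then show ?case using Cons by auto
  qed simp
  then have Es: "sorted_wrt (\<lambda>A B. A \<inter> B = {}) Es" using xs by (simp add: Es_def)
  have UnEs: "\<Union>(set Es) = E" using E xs by (simp add: Es_def)
  define D where "D = map (\<lambda>(t, Z). (monomial t :: ('n, 'k) mpoly, Z)) xs"
  have V: "map (\<lambda>(u, Z). stanley_subspace (*) u Z) D = map supported Es"
    by (simp add: D_def Es_def monomial_def stanley_subspace_term split_beta)
  have sub: "t \<in> E" if "(t, Z) \<in> F" for t Z using that E self_mem_box by blast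
  have "stanley_decomposition (*) (\<lambda>a. ?I \<inter> degree_part a) ?I D"
    unfolding stanley_decomposition_def
  proof
    show "\<forall>(u, Z)\<in>set D. u \<in> ?I \<and> (\<exists>a. u \<in> ?I \<inter> degree_part a) \<and> stanley_space (*) u Z"
    proof clarify
      fix u Z assume "(u, Z) \<in> set D"
      then obtain t where t: "(t, Z) \<in> F" "u = monomial t" using xs by (auto simp: D_def)
      then have "u \<in> ?I" using sub by (simp add: monomial_def)
      then show "u \<in> ?I \<and> (\<exists>a. u \<in> ?I \<inter> degree_part a) \<and> stanley_space (*) u Z"
        using t stanley_space_monomial single_in_degree_part by (fastforce simp: monomial_def)
    qed
    show "direct_sum ?I (map (\<lambda>(u, Z). stanley_subspace (*) u Z) D)"
      using direct_sum_supported[OF Es] by (simp add: V UnEs)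
  qed
  moreover have "k \<le> decomposition_sdepth D"
  proof -
    \<comment> \<open>Nonemptiness makes the minimum defining the depth meaningful.\<close>
    have "set D \<noteq> {}" using \<open>E \<noteq> {}\<close> E xs by (auto simp: D_def)
    then show ?thesis unfolding decomposition_sdepth_def
      using cardF xs by (subst Min_ge_iff) (auto simp: D_def)
  qed
  ultimately show thesis using that by blast
qed

section \<open>Upper bound: decompositions of full depth\<close>

lemma principal_if_full_sdepth:
  fixes I :: "('n::finite, 'k::field) mpoly set"
  assumes D: "stanley_decomposition (*) (\<lambda>a. I \<inter> degree_part a) I D"
    and full: "CARD('n) \<le> decomposition_sdepth D" and I: "\<not> I \<subseteq> {0}"
  obtains t where "I = supported (box t UNIV)"
proof -
  have single: "\<exists>t c. u = Poly_Mapping.single t c \<and> c \<noteq> 0" if uZ: "(u, Z) \<in> set D" for u Z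
  proof -
    obtain a where "u \<in> degree_part a" "u \<noteq> 0"
      using D uZ by (fastforce simp: stanley_decomposition_def stanley_space_def)
    then show ?thesis using homogeneous_term by blast
  qed
  have Z: "Z = UNIV" if "(u, Z) \<in> set D" for u Z
  proof -
    have "decomposition_sdepth D \<le> card Z"
      unfolding decomposition_sdepth_def using that by (intro Min_le) (auto intro: rev_image_eqI)
    then show ?thesis using full by (metis card_subset_eq card_mono finite subset_UNIV le_antisym le_trans)
  qed
  have ds: "direct_sum I (map (\<lambda>(u, Z). stanley_subspace (*) u Z) D)"
    using D by (simp add: stanley_decomposition_def)
  \<comment> \<open>The empty sum is 0, so an empty decomposition would leave no nonzero element in
    \<open>I\<close>.\<close>
  have ne: "D \<noteq> []"
    using ds I by (auto simp: direct_sum_def)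
  show thesis
  proof (cases "tl D")
    case Nil
    then obtain u Y where uY: "D = [(u, Y)]" using ne by (cases D) auto
    then obtain t c where t: "u = Poly_Mapping.single t c" "c \<noteq> 0" and Y: "Y = UNIV" using single Z by fastforce
    have V: "direct_sum I [supported (box t UNIV)]"
      using ds by (simp add: uY t Y stanley_subspace_term)
    have "I = supported (box t UNIV)"
    proof
      show "supported (box t UNIV) \<subseteq> I" using V by (simp add: direct_sum_def)
      show "I \<subseteq> supported (box t UNIV)"
      proof
        fix x assume "x \<in> I"
        then obtain vs where "list_all2 (\<in>) vs [supported (box t UNIV)]" "sum_list vs = x"
          using V unfolding direct_sum_def by blast
        then show "x \<in> supported (box t UNIV)" by (auto simp: list_all2_Cons2)
      qed
    qed
    then show thesis by (rule that)
  next
    case (Cons y D')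
    then obtain x where Dxy: "D = x # y # D'" using ne by (cases D) auto
    obtain t c t' c' where t: "fst x = Poly_Mapping.single t c" "c \<noteq> 0"
        "fst y = Poly_Mapping.single t' c'" "c' \<noteq> 0"
      using single[of "fst x" "snd x"] single[of "fst y" "snd y"] by (auto simp: Dxy)
    have xy: "snd x = UNIV" "snd y = UNIV"
      using Z[of "fst x" "snd x"] Z[of "fst y" "snd y"] by (auto simp: Dxy)
    have "direct_sum I (supported (box t UNIV) # supported (box t' UNIV) #
        map (\<lambda>(u, Z). stanley_subspace (*) u Z) D')"
      using ds by (simp add: Dxy split_beta t xy stanley_subspace_term)
    \<comment> \<open>The product of the two generators, up to a scalar, lies in both full
      summands.\<close>
    then have "(monomial (t + t') :: ('n, 'k) mpoly) = 0"
    proof (rule direct_sum_two_disjoint)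
      show "monomial (t + t') \<in> (supported (box t UNIV) :: ('n, 'k) mpoly set)"
           "monomial (t + t') \<in> (supported (box t' UNIV) :: ('n, 'k) mpoly set)"
        by (auto simp: monomial_def mem_box_iff lookup_add)
      have "0 \<in> stanley_subspace (*) u Z" if "(u, Z) \<in> set D'" for u Z
        unfolding stanley_subspace_def by (rule vec.span_zero)
      then show "\<forall>U\<in>set (supported (box t UNIV) # supported (box t' UNIV) #
          map (\<lambda>(u, Z). stanley_subspace (*) u Z) D'). 0 \<in> U"
        by auto
    qed
    then show thesis using monomial_neq_0 by blast
  qed
qed

text \<open>If x^t generated \<open>I\<close>, some generator x^g would divide x^t, while x^t
  divides every monomial of \<open>I\<close>, including x^g. Hence x^g alone generates
  \<open>I\<close>, against minimality of a set with more than one element.\<close>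

lemma minimal_generators_not_principal:
  fixes I G :: "('n, 'k::field) mpoly set"
  assumes G: "minimal_monomial_generators G I" and "card G > 1"
  shows "I \<noteq> supported (box t UNIV)"
proof
  assume I: "I = supported (box t UNIV)"
  obtain T where T: "G = monomial ` T"
    using G by (auto simp: minimal_monomial_generators_def subset_image_iff)
  have span: "supported (\<Union>s\<in>T. box s UNIV) = I"
    using G by (simp add: minimal_monomial_generators_def T span_monomials)
  have "monomial t \<in> I" by (simp add: I) (simp add: monomial_def self_mem_box)
  then obtain g where g: "g \<in> T" "t \<in> box g UNIV"
    unfolding span[symmetric] by (auto simp: monomial_def)
  have "monomial g \<in> I" unfolding span[symmetric] using g by (auto simp: monomial_def intro: self_mem_box)
  then have "g \<in> box t UNIV" unfolding I by (simp add: monomial_def)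
  then have "box t UNIV = box g UNIV" using g box_subset by blast
  then have "ideal.span {monomial g} = I"
    using span_monomials[of "{g}", where 'k = 'k] by (simp add: I)
  moreover have "{monomial g} \<noteq> G" using \<open>card G > 1\<close> by auto
  then have "{monomial g} \<subset> G" using g by (auto simp: T)
  ultimately show False using G by (auto simp: minimal_monomial_generators_def)
qed

theorem proposition3p8:
  fixes I G :: "('n::finite, 'k::field) mpoly set"
  assumes "monomial_complete_intersection I"
    and "minimal_monomial_generators G I" and "card G = 3"
  shows "ideal_sdepth I = CARD('n) - 1"
proof -
  have "G \<subseteq> range monomial" and span: "ideal.span G = I"
    using assms(2) unfolding minimal_monomial_generators_def by blast+
  \<comment> \<open>Choosing the exponents injectively transfers the cardinality 3 from generators
    to exponent vectors.\<close>
  then obtain T where T: "inj_on (monomial :: _ \<Rightarrow> ('n, 'k) mpoly) T" "G = monomial ` T"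
    unfolding subset_image_inj by blast
  then have "card T = 3" using assms(3) by (simp add: card_image)
  then obtain a b c where abc: "T = {a, b, c}" by (auto simp: card_3_iff)
  define E where "E = box a UNIV \<union> box b UNIV \<union> box c UNIV"
  have I: "I = supported E"
    unfolding span[symmetric] T(2) span_monomials by (simp add: abc E_def Un_assoc)
  have aE: "a \<in> E" by (simp add: E_def self_mem_box)
  obtain F where "box_partition (CARD('n) - 1) F E" using box_partition_three E_def by metis
  then obtain D where D: "stanley_decomposition (*) (\<lambda>a. I \<inter> degree_part a) I D"
      "CARD('n) - 1 \<le> decomposition_sdepth D"
    unfolding I using stanley_decomposition_of_box_partition aE by blast
  have "monomial a \<in> I" using aE by (simp add: I monomial_def)
  then have "\<not> I \<subseteq> {0}" using monomial_neq_0 by blast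
  have upper: "decomposition_sdepth D' \<le> CARD('n) - 1"
    if D': "stanley_decomposition (*) (\<lambda>a. I \<inter> degree_part a) I D'" for D'
  proof (rule ccontr)
    assume "\<not> decomposition_sdepth D' \<le> CARD('n) - 1"
    then have "CARD('n) \<le> decomposition_sdepth D'" by simp
    then obtain t where "I = supported (box t UNIV)"
      using principal_if_full_sdepth[OF D' _ \<open>\<not> I \<subseteq> {0}\<close>] by blast
    then show False using minimal_generators_not_principal[OF assms(2)] assms(3) by simp
  qed
  then have "decomposition_sdepth D = CARD('n) - 1" using D by (simp add: le_antisym)
  \<comment> \<open>The upper bound also makes the set of depths finite, so that its
    \<open>Max\<close> is attained.\<close>
  moreover have "finite {decomposition_sdepth D' |D'. stanley_decomposition (*) (\<lambda>a. I \<inter> degree_part a) I D'}"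
    by (rule finite_subset[of _ "{..CARD('n) - 1}"]) (use upper in auto)
  ultimately show ?thesis
    unfolding ideal_sdepth_def sdepth_def using D(1) upper by (intro Max_eqI) (auto, metis)
qed

end
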